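(* Let $q=2^m$ with $m\ge 1$. Every extended cyclic code over $\mathbb{F}_q$ with parameters $[q+2,3,q]$ is equivalent to an MDS code obtained from a regular hyperoval of $PG(2,q)$.
   Context: A linear code of length $n$ over $\mathbb{F}_q$ is cyclic if it is invariant under the cyclic shift of coordinates. The extended code of a linear code $C$ of length $n$ is $\{(c_0,\dots,c_{n-1},-\sum_{i}c_i) : (c_0,\dots,c_{n-1})\in C\}$; an extended cyclic code is the extended code of a cyclic code. Two codes are equivalent if one is obtained from the other by a permutation of coordinates and multiplication of coordinates by nonzero scalars. A hyperoval in $PG(2,q)$ ($q$ even) is a set of $q+2$ points no three of which are collinear; a regular hyperoval is a nondegenerate conic together with its nucleus (the common point of its tangent lines). The code obtained from a set of points $\{P_1,\dots,P_n\}$ of $PG(2,q)$ is the linear code generated by the $3\times n$ matrix whose columns are coordinate vectors of $P_1,\dots,P_n$. An $[n,k,d]$ code is MDS if $d=n-k+1$. *)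

theory Defs
  imports "Jordan_Normal_Form.VS_Connect" "HOL-Library.Cardinality" "HOL-Combinatorics.Permutations"
begin

definition linear_code :: "nat \<Rightarrow> 'a::field vec set \<Rightarrow> bool" where
  "linear_code n C \<longleftrightarrow> VectorSpace.subspace class_ring C (module_vec TYPE('a) n)"

definition code_dim :: "nat \<Rightarrow> 'a::field vec set \<Rightarrow> nat" where
  "code_dim n C = vectorspace.dim class_ring ((module_vec TYPE('a) n)\<lparr>carrier := C\<rparr>)"

definition hamming_dist :: "'a vec \<Rightarrow> 'a vec \<Rightarrow> nat" where
  "hamming_dist x y = card {i. i < dim_vec x \<and> x $ i \<noteq> y $ i}"

text \<open>Only meaningful for codes with at least two words.\<close>

definition min_dist :: "'a vec set \<Rightarrow> nat" where
  "min_dist C = Min {hamming_dist x y |x y. x \<in> C \<and> y \<in> C \<and> x \<noteq> y}"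

definition code_params :: "nat \<Rightarrow> nat \<Rightarrow> nat \<Rightarrow> 'a::field vec set \<Rightarrow> bool" where
  "code_params n k d C \<longleftrightarrow> linear_code n C \<and> code_dim n C = k \<and> min_dist C = d"

definition mds_code :: "nat \<Rightarrow> 'a::field vec set \<Rightarrow> bool" where
  "mds_code n C \<longleftrightarrow> (\<exists>k d. code_params n k d C \<and> d = n - k + 1)"

definition cyclic_shift :: "nat \<Rightarrow> 'a vec \<Rightarrow> 'a vec" where
  "cyclic_shift n c = vec n (\<lambda>i. c $ ((i + 1) mod n))"

definition cyclic_code :: "nat \<Rightarrow> 'a::field vec set \<Rightarrow> bool" where
  "cyclic_code n C \<longleftrightarrow> linear_code n C \<and> (\<forall>c\<in>C. cyclic_shift n c \<in> C)"

definition extended_code :: "nat \<Rightarrow> 'a::field vec set \<Rightarrow> 'a vec set" where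
  "extended_code n C =
     (\<lambda>c. vec (n + 1) (\<lambda>i. if i < n then c $ i else - (\<Sum>j<n. c $ j))) ` C"

definition extended_cyclic_code :: "'a::field vec set \<Rightarrow> bool" where
  "extended_cyclic_code E \<longleftrightarrow> (\<exists>n C. cyclic_code n C \<and> E = extended_code n C)"

definition code_equiv :: "nat \<Rightarrow> 'a::field vec set \<Rightarrow> 'a vec set \<Rightarrow> bool" where
  "code_equiv n C D \<longleftrightarrow>
     (\<exists>\<pi> s. \<pi> permutes {..<n} \<and> (\<forall>i<n. s i \<noteq> 0) \<and>
        D = (\<lambda>c. vec n (\<lambda>i. s i * c $ \<pi> i)) ` C)"

definition proj_point :: "'a::field vec \<Rightarrow> 'a vec set" where
  "proj_point v = {c \<cdot>\<^sub>v v |c. True}"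

definition pg_points :: "'a::field vec set set" where
  "pg_points = {proj_point v |v. v \<in> carrier_vec 3 \<and> v \<noteq> 0\<^sub>v 3}"

definition pg_line :: "'a::field vec \<Rightarrow> 'a vec set set" where
  "pg_line a = {P \<in> pg_points. \<forall>x\<in>P. a \<bullet> x = 0}"

definition pg_lines :: "'a::field vec set set set" where
  "pg_lines = {pg_line a |a. a \<in> carrier_vec 3 \<and> a \<noteq> 0\<^sub>v 3}"

definition pg_collinear :: "'a::field vec set \<Rightarrow> 'a vec set \<Rightarrow> 'a vec set \<Rightarrow> bool" where
  "pg_collinear P Q R \<longleftrightarrow> (\<exists>L\<in>pg_lines. P \<in> L \<and> Q \<in> L \<and> R \<in> L)"

definition hyperoval :: "'a::{field,finite} vec set set \<Rightarrow> bool" where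
  "hyperoval H \<longleftrightarrow> H \<subseteq> pg_points \<and> card H = CARD('a) + 2 \<and>
     (\<forall>P\<in>H. \<forall>Q\<in>H. \<forall>R\<in>H. P \<noteq> Q \<and> P \<noteq> R \<and> Q \<noteq> R \<longrightarrow> \<not> pg_collinear P Q R)"

text \<open>Every ternary quadratic form arises from some (not necessarily symmetric) \<open>3 \<times> 3\<close> matrix;
  an upper triangular one lists its six coefficients.\<close>

definition quad_form :: "'a::field mat \<Rightarrow> 'a vec \<Rightarrow> 'a" where
  "quad_form A x = x \<bullet> (A *\<^sub>v x)"

definition polar_form :: "'a::field mat \<Rightarrow> 'a vec \<Rightarrow> 'a vec \<Rightarrow> 'a" where
  "polar_form A x y = quad_form A (x + y) - quad_form A x - quad_form A y"

text \<open>In characteristic 2 the polar form of a ternary quadratic form is alternating and hence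
  always degenerate. The form itself is nondegenerate iff it does not vanish at any nonzero
  vector of the radical of its polar form. As a finite field is perfect, this means that the
  conic has no singular point, even over the algebraic closure.\<close>

definition nondegenerate_form :: "'a::field mat \<Rightarrow> bool" where
  "nondegenerate_form A \<longleftrightarrow>
     (\<forall>v\<in>carrier_vec 3. (\<forall>u\<in>carrier_vec 3. polar_form A v u = 0) \<and> quad_form A v = 0
        \<longrightarrow> v = 0\<^sub>v 3)"

definition conic :: "'a::field mat \<Rightarrow> 'a vec set set" where
  "conic A = {P \<in> pg_points. \<forall>x\<in>P. quad_form A x = 0}"

definition nondegenerate_conic :: "'a::field vec set set \<Rightarrow> bool" where
  "nondegenerate_conic K \<longleftrightarrow> (\<exists>A\<in>carrier_mat 3 3. nondegenerate_form A \<and> K = conic A)"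

definition tangent_line :: "'a::field vec set set \<Rightarrow> 'a vec set set \<Rightarrow> bool" where
  "tangent_line K L \<longleftrightarrow> L \<in> pg_lines \<and> card (L \<inter> K) = 1"

definition nucleus :: "'a::field vec set set \<Rightarrow> 'a vec set \<Rightarrow> bool" where
  "nucleus K N \<longleftrightarrow> N \<in> pg_points \<and> (\<forall>L. tangent_line K L \<longrightarrow> N \<in> L)"

definition regular_hyperoval :: "'a::{field,finite} vec set set \<Rightarrow> bool" where
  "regular_hyperoval H \<longleftrightarrow> hyperoval H \<and>
     (\<exists>K N. nondegenerate_conic K \<and> nucleus K N \<and> H = insert N K)"

text \<open>The code depends on the order of the points and on the choice of their coordinate vectors,
  so this is a relation: the columns of \<open>G\<close> are coordinate vectors of the points of \<open>S\<close>, each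
  point occurring exactly once, and \<open>D\<close> is the row space of \<open>G\<close>.\<close>

definition code_from_points :: "'a::field vec set set \<Rightarrow> 'a vec set \<Rightarrow> bool" where
  "code_from_points S D \<longleftrightarrow>
     (\<exists>G\<in>carrier_mat 3 (card S).
        bij_betw (\<lambda>j. proj_point (col G j)) {..<card S} S \<and>
        D = LinearCombinations.module.span class_ring (module_vec TYPE('a) (card S)) (set (rows G)))"

end

theory Submission
  imports Defs
begin

text \<open>
  Two words of the code that agree in three coordinates coincide, and by counting any three
  coordinates can be prescribed. Let \<open>x, y, z\<close> be the words that are unit vectors at the
  coordinates \<open>0, 1, q + 1\<close>. Cyclicity makes their entries satisfy the linear recurrence
  \<open>x\<^sub>i\<^sub>+\<^sub>1 = \<alpha>y\<^sub>i\<close>, \<open>y\<^sub>i\<^sub>+\<^sub>1 = x\<^sub>i + \<beta>y\<^sub>i\<close>, \<open>z\<^sub>i\<^sub>+\<^sub>1 = z\<^sub>i + \<gamma>y\<^sub>i\<close>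
  with period \<open>q + 1\<close>. The determinant of the recurrence forces \<open>\<alpha> = 1\<close>, the form
  \<open>x\<^sup>2 + \<beta>xy + y\<^sup>2\<close> is invariant and hence equal to 1, and the parity check together with an
  invariant linear functional gives \<open>z = 1 + x + y\<close>. In characteristic 2 these combine to
  \<open>z\<^sup>2 = \<beta>xy\<close>: the first \<open>q + 1\<close> columns are the points of a conic, and the last one
  is its nucleus \<open>(0, 0, 1)\<close>.
\<close>

section \<open>Characteristic 2\<close>

text \<open>Translation by 1 permutes the field, so comparing the sum of all elements before and
  after gives \<open>of_nat CARD('a) = 0\<close>, a power of 2 that vanishes.\<close>

lemma two_eq_zero_of_card_power_two:
  assumes "CARD('a::{field,finite}) = 2 ^ m"
  shows "(2::'a) = 0"
proof -
  have "(\<Sum>x\<in>(UNIV::'a set). x) = (\<Sum>x\<in>UNIV. x + 1)"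
    by (rule sum.reindex_bij_witness[of _ "\<lambda>x. x + 1" "\<lambda>x. x - 1"]) auto
  hence "of_nat CARD('a) = (0::'a)"
    by (simp add: sum.distrib)
  thus ?thesis
    by (simp add: assms)
qed

text \<open>Multiplication by \<open>a\<close> permutes the nonzero elements; their product is
  nonzero and cancels.\<close>

lemma power_card_minus_one:
  fixes a :: "'a::{field,finite}"
  assumes "a \<noteq> 0"
  shows "a ^ (CARD('a) - 1) = 1"
proof -
  have "\<Prod>(UNIV - {0::'a}) = (\<Prod>y\<in>UNIV - {0}. a * y)"
    by (rule prod.reindex_bij_witness[of _ "\<lambda>y. a * y" "\<lambda>y. y / a"]) (use assms in auto)
  also have "\<dots> = a ^ (CARD('a) - 1) * \<Prod>(UNIV - {0::'a})"
    by (simp add: prod.distrib card_Diff_singleton)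
  finally show ?thesis
    by (simp add: prod_zero_iff)
qed

text \<open>Adding a double to one side lets ring normalisation prove the identities below,
  which hold only in characteristic 2.\<close>

lemma eq_mod_two:
  fixes a b c :: "'a::comm_ring_1"
  assumes "(2::'a) = 0" and "a = b + (c + c)"
  shows "a = b"
  using assms by (simp flip: mult_2)

lemma add_self_eq_zero:
  fixes a :: "'a::comm_ring_1"
  assumes "(2::'a) = 0"
  shows "a + a = 0"
  using assms by (simp flip: mult_2)

lemma uminus_eq_self:
  fixes a :: "'a::comm_ring_1"
  assumes "(2::'a) = 0"
  shows "- a = a"
  using add_self_eq_zero[OF assms, of a] by (simp add: add_eq_0_iff)

lemma add_eq_zero_iff_eq:
  fixes a b :: "'a::comm_ring_1"
  assumes "(2::'a) = 0"
  shows "a + b = 0 \<longleftrightarrow> a = b"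
  by (metis add_eq_0_iff assms uminus_eq_self)

text \<open>Squaring is additive in characteristic 2, so \<open>(a + 1)\<^sup>2\<close> equals
  \<open>a\<^sup>2 + 1\<close>, which is zero.\<close>

lemma square_eq_one_iff_char_two:
  fixes a :: "'a::field"
  assumes "(2::'a) = 0" and "a\<^sup>2 = 1"
  shows "a = 1"
proof -
  have "(a + 1)\<^sup>2 = 0"
    by (rule eq_mod_two[OF assms(1), of _ _ "a + 1"])
       (use assms(2) in \<open>simp add: power2_eq_square algebra_simps\<close>)
  thus ?thesis
    using assms(1) by (simp add: add_eq_zero_iff_eq)
qed

lemma odd_of_nat_char_two:
  assumes "(2::'a::comm_ring_1) = 0" and "odd n"
  shows "of_nat n = (1::'a)"
proof -
  from \<open>odd n\<close> obtain k where "n = 2 * k + 1"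
    by (rule oddE)
  thus ?thesis
    using assms(1) by simp
qed

section \<open>The linear recurrence induced by the cyclic shift\<close>

text \<open>Isolates the field arithmetic from the code. \<open>sums\<close> is the parity check,
  without sign in characteristic 2; the condition on \<alpha> in \<open>coeffs\<close> is what the
  order of the multiplicative group gives for \<open>n = q + 1\<close>.\<close>

locale shift_recurrence =
  fixes x y z :: "nat \<Rightarrow> 'a::field" and \<alpha> \<beta> \<gamma> :: 'a and n :: nat
  assumes two: "(2::'a) = 0"
    and init: "x 0 = 1" "y 0 = 0" "z 0 = 0"
    and x_Suc: "\<And>i. x (Suc i) = \<alpha> * y i"
    and y_Suc: "\<And>i. y (Suc i) = x i + \<beta> * y i"
    and z_Suc: "\<And>i. z (Suc i) = z i + \<gamma> * y i"
    and period: "x n = 1" "y n = 0"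
    and odd: "odd n"
    and coeffs: "\<beta> \<noteq> 0" "\<alpha> \<noteq> 0 \<Longrightarrow> \<alpha> ^ n = \<alpha>\<^sup>2"
    and sums: "(\<Sum>i<n. x i) = 0" "(\<Sum>i<n. y i) = 0" "(\<Sum>i<n. z i) = 1"
begin

lemma alpha_eq_one: "\<alpha> = 1"
proof -
  \<comment> \<open>the shift multiplies the determinant of two consecutive columns by \<open>\<alpha>\<close>\<close>
  define D where "D i = x i * y (Suc i) + y i * x (Suc i)" for i
  have "D i = \<alpha> ^ i" for i
  proof (induction i)
    case 0
    show ?case by (simp add: D_def init x_Suc y_Suc)
  next
    case (Suc i)
    have "D (Suc i) = \<alpha> * D i"
      unfolding D_def x_Suc y_Suc
      by (rule eq_mod_two[OF two, of _ _ "\<alpha> * \<beta> * x i * y i + \<alpha> * \<beta> * \<beta> * y i * y i"])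
         (simp add: algebra_simps)
    thus ?case using Suc by simp
  qed
  \<comment> \<open>After a full period the columns, and hence \<open>D\<close>, are back at their
    initial values.\<close>
  from this[of n] have "\<alpha> ^ n = 1"
    by (simp add: D_def period x_Suc y_Suc)
  \<comment> \<open>An odd \<open>n\<close> is positive, so \<alpha> = 0 would give 0 = 1.\<close>
  moreover from this have "\<alpha> \<noteq> 0"
    using odd by (auto simp: power_0_left split: if_splits)
  ultimately show ?thesis
    using coeffs(2) two square_eq_one_iff_char_two by metis
qed

text \<open>Invariance of the norm form of the quadratic extension defined by
  \<open>T\<^sup>2 + \<beta>T + 1\<close>.\<close>

lemma norm_eq_one: "(x i)\<^sup>2 + \<beta> * x i * y i + (y i)\<^sup>2 = 1"
proof (induction i)
  case 0
  show ?case by (simp add: init)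
next
  case (Suc i)
  have "(x (Suc i))\<^sup>2 + \<beta> * x (Suc i) * y (Suc i) + (y (Suc i))\<^sup>2
      = (x i)\<^sup>2 + \<beta> * x i * y i + (y i)\<^sup>2"
    unfolding x_Suc y_Suc alpha_eq_one
    by (rule eq_mod_two[OF two, of _ _ "\<beta> * x i * y i + \<beta>\<^sup>2 * (y i)\<^sup>2"])
       (simp add: power2_eq_square algebra_simps)
  thus ?case using Suc by simp
qed

text \<open>A shift-invariant functional is constant along the recurrence; the parity check fixes
  its value.\<close>

lemma z_eq: "z i = 1 + x i + y i"
proof -
  define u where "u = \<gamma> / \<beta>"
  have \<gamma>: "\<gamma> = u * \<beta>"
    using coeffs(1) by (simp add: u_def)
  have const: "z i + u * (x i + y i) = u" for i
  proof (induction i)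
    case 0
    show ?case by (simp add: init)
  next
    case (Suc i)
    have "z (Suc i) + u * (x (Suc i) + y (Suc i)) = z i + u * (x i + y i)"
      unfolding x_Suc y_Suc z_Suc alpha_eq_one \<gamma>
      by (rule eq_mod_two[OF two, of _ _ "u * \<beta> * y i"]) (simp add: algebra_simps)
    thus ?case using Suc by simp
  qed
  \<comment> \<open>The same sum consists of \<open>n\<close> copies of \<open>u\<close>, and
    \<open>n\<close> is 1 in the field because it is odd.\<close>
  have "(\<Sum>i<n. z i + u * (x i + y i)) = 1"
    using sums by (simp add: sum.distrib flip: sum_distrib_left)
  hence "u = 1"
    unfolding const using odd_of_nat_char_two[OF two odd] by simp
  thus ?thesis
    using const[of i] uminus_eq_self[OF two, of "x i + y i"]
    by (metis add.assoc diff_eq_eq mult_1 uminus_add_conv_diff add.commute)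
qed

text \<open>Squaring \<open>z_eq\<close> termwise leaves \<open>x\<^sup>2 + y\<^sup>2 + 1\<close>;
  replacing 1 by the norm form cancels the squares.\<close>

lemma on_conic: "(z i)\<^sup>2 = \<beta> * x i * y i"
proof -
  have "(z i)\<^sup>2 = (x i)\<^sup>2 + (y i)\<^sup>2 + 1"
    unfolding z_eq
    by (rule eq_mod_two[OF two, of _ _ "x i + y i + x i * y i"])
       (simp add: power2_eq_square algebra_simps)
  also have "\<dots> = \<beta> * x i * y i"
    unfolding norm_eq_one[of i, symmetric]
    by (rule eq_mod_two[OF two, of _ _ "(x i)\<^sup>2 + (y i)\<^sup>2"]) (simp add: algebra_simps)
  finally show ?thesis .
qed

end

section \<open>Linear codes\<close>

lemma linear_codeD:
  assumes "linear_code n (C :: 'a::field vec set)"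
  shows "C \<subseteq> carrier_vec n" and "0\<^sub>v n \<in> C"
    and "\<And>c d. c \<in> C \<Longrightarrow> d \<in> C \<Longrightarrow> c + d \<in> C"
    and "\<And>a c. c \<in> C \<Longrightarrow> a \<cdot>\<^sub>v c \<in> C"
proof -
  have "submodule class_ring C (module_vec TYPE('a) n)"
    using assms by (simp add: linear_code_def subspace_def)
  from submodule.subset[OF this] submodule.zero_closed[OF this] submodule.m_closed[OF this]
    submodule.smult_closed[OF this]
  show "C \<subseteq> carrier_vec n" and "0\<^sub>v n \<in> C"
    and "\<And>c d. c \<in> C \<Longrightarrow> d \<in> C \<Longrightarrow> c + d \<in> C"
    and "\<And>a c. c \<in> C \<Longrightarrow> a \<cdot>\<^sub>v c \<in> C"
    by (auto simp: module_vec_simps class_ring_simps)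
qed

lemma finite_linear_code:
  assumes "linear_code n (C :: 'a::{field,finite} vec set)"
  shows "finite C"
proof -
  have "carrier_vec n \<subseteq> vec_of_list ` {xs :: 'a list. set xs \<subseteq> UNIV \<and> length xs = n}"
  proof
    fix v :: "'a vec"
    assume "v \<in> carrier_vec n"
    thus "v \<in> vec_of_list ` {xs :: 'a list. set xs \<subseteq> UNIV \<and> length xs = n}"
      by (intro image_eqI[of _ _ "list_of_vec v"]) (auto simp: vec_list)
  qed
  hence "finite (carrier_vec n :: 'a vec set)"
    by (rule finite_subset) (intro finite_imageI finite_lists_length_eq finite)
  thus ?thesis
    using linear_codeD(1)[OF assms] finite_subset by blast
qed

text \<open>Unique expansion in a basis \<open>B\<close> puts the words in bijection with the
  coefficient functions on \<open>B\<close>.\<close>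

lemma card_linear_code:
  fixes C :: "'a::{field,finite} vec set"
  assumes "linear_code n C"
  shows "card C = CARD('a) ^ code_dim n C"
proof -
  interpret V: vectorspace class_ring "module_vec TYPE('a) n"
    by (rule vec_vs)
  interpret C: vectorspace class_ring "(module_vec TYPE('a) n)\<lparr>carrier := C\<rparr>"
    using assms unfolding linear_code_def by (rule V.subspace_is_vs)
  \<comment> \<open>The code generates itself and is finite, so it has a finite basis.\<close>
  have "C.gen_set C"
    using C.in_own_span[of C] C.span_is_subset2[of C] by auto
  hence "C.fin_dim"
    unfolding C.fin_dim_def using finite_linear_code[OF assms] by auto
  then obtain B where B: "finite B" "C.basis B"
    using C.finite_basis_exists by blast
  hence "B \<subseteq> C"
    by (simp add: C.basis_def)
  have ex1: "\<forall>v\<in>C. \<exists>!a. a \<in> B \<rightarrow>\<^sub>E (UNIV :: 'a set) \<and> C.lincomb a B = v"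
    using C.basis_criterion[of B] B \<open>B \<subseteq> C\<close> by (simp add: class_ring_simps)
  have "bij_betw (\<lambda>a. C.lincomb a B) (B \<rightarrow>\<^sub>E (UNIV :: 'a set)) C"
    unfolding bij_betw_def
  proof
    have closed: "C.lincomb a B \<in> C" for a
      using C.lincomb_closed[of B a] \<open>B \<subseteq> C\<close> by (simp add: class_ring_simps)
    show "inj_on (\<lambda>a. C.lincomb a B) (B \<rightarrow>\<^sub>E (UNIV :: 'a set))"
    proof (rule inj_onI)
      fix a b
      assume "a \<in> B \<rightarrow>\<^sub>E UNIV" "b \<in> B \<rightarrow>\<^sub>E UNIV" "C.lincomb a B = C.lincomb b B"
      with bspec[OF ex1 closed[of b]] show "a = b"
        by (elim ex1E) metis
    qed
    show "(\<lambda>a. C.lincomb a B) ` (B \<rightarrow>\<^sub>E (UNIV :: 'a set)) = C"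
    proof (intro equalityI subsetI)
      fix v
      assume "v \<in> C"
      from ex1_implies_ex[OF bspec[OF ex1 this]]
      obtain a where "a \<in> B \<rightarrow>\<^sub>E (UNIV :: 'a set)" "v = C.lincomb a B"
        by (elim exE conjE) (rule that, assumption, rule sym)
      thus "v \<in> (\<lambda>a. C.lincomb a B) ` (B \<rightarrow>\<^sub>E (UNIV :: 'a set))"
        by (intro image_eqI[of v "\<lambda>a. C.lincomb a B" a])
    qed (use closed in \<open>elim imageE, simp only:\<close>)
  qed
  hence "card C = card (B \<rightarrow>\<^sub>E (UNIV :: 'a set))"
    by (metis bij_betw_same_card)
  also have "\<dots> = CARD('a) ^ card B"
    using B(1) by (simp add: card_PiE)
  also have "card B = code_dim n C"
    using C.dim_basis[OF B] by (simp add: code_dim_def)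
  finally show ?thesis .
qed

lemma min_dist_le_hamming_dist:
  assumes "finite C" and "x \<in> C" and "y \<in> C" and "x \<noteq> y"
  shows "min_dist C \<le> hamming_dist x y"
proof -
  have "{hamming_dist x y |x y. x \<in> C \<and> y \<in> C \<and> x \<noteq> y}
      \<subseteq> (\<lambda>(x, y). hamming_dist x y) ` (C \<times> C)"
    by auto
  hence "finite {hamming_dist x y |x y. x \<in> C \<and> y \<in> C \<and> x \<noteq> y}"
    using assms(1) finite_subset by blast
  thus ?thesis
    unfolding min_dist_def using assms by (intro Min_le) auto
qed

text \<open>Words agreeing on \<open>I\<close> differ in at most \<open>n - card I\<close> places,
  fewer than the minimum distance.\<close>

lemma code_word_eqI:
  fixes C :: "'a::{field,finite} vec set"
  assumes "code_params n k d C" and "n < card I + d" and "I \<subseteq> {..<n}"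
    and "x \<in> C" and "y \<in> C" and "\<And>i. i \<in> I \<Longrightarrow> x $ i = y $ i"
  shows "x = y"
proof (rule ccontr)
  assume "x \<noteq> y"
  have lin: "linear_code n C" and "min_dist C = d"
    using assms(1) by (auto simp: code_params_def)
  have "dim_vec x = n"
    using linear_codeD(1)[OF lin] assms(4) by auto
  hence "{i. i < dim_vec x \<and> x $ i \<noteq> y $ i} \<subseteq> {..<n} - I"
    using assms(6) by auto
  hence "hamming_dist x y \<le> card ({..<n} - I)"
    unfolding hamming_dist_def by (intro card_mono) auto
  also have "\<dots> = n - card I"
    using assms(3) by (simp add: card_Diff_subset finite_subset)
  finally have "hamming_dist x y \<le> n - card I" .
  moreover have "d \<le> hamming_dist x y"
    using min_dist_le_hamming_dist[OF finite_linear_code[OF lin] assms(4,5) \<open>x \<noteq> y\<close>]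
      \<open>min_dist C = d\<close> by simp
  moreover have "card I \<le> n"
    using card_mono[OF _ assms(3)] by simp
  ultimately show False
    using assms(2) by linarith
qed

text \<open>Restriction to \<open>I\<close> is injective by the minimum distance. The code and the
  set of value assignments on \<open>I\<close> have equal size, so restriction is also
  surjective.\<close>

lemma mds_code_interpolation:
  fixes C :: "'a::{field,finite} vec set"
  assumes "code_params n k (n - k + 1) C" and "I \<subseteq> {..<n}" and "card I = k"
  obtains c where "c \<in> C" and "\<And>i. i \<in> I \<Longrightarrow> c $ i = f i"
proof -
  have "finite I"
    using assms(2) finite_subset by blast
  have "k \<le> n"
    using card_mono[OF _ assms(2)] assms(3) by simp
  have lin: "linear_code n C" and "code_dim n C = k"
    using assms(1) by (auto simp: code_params_def)
  let ?r = "\<lambda>c. restrict (($) c) I"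
  have "inj_on ?r C"
  proof (rule inj_onI)
    fix x y
    assume "x \<in> C" "y \<in> C" and eq: "?r x = ?r y"
    moreover have "x $ i = y $ i" if "i \<in> I" for i
      using fun_cong[OF eq, of i] that by simp
    ultimately show "x = y"
      using \<open>k \<le> n\<close> assms(2,3) by (intro code_word_eqI[OF assms(1), of I]) auto
  qed
  moreover have "card C = card (I \<rightarrow>\<^sub>E (UNIV :: 'a set))"
    using card_linear_code[OF lin] \<open>code_dim n C = k\<close> \<open>finite I\<close> assms(3) by (simp add: card_PiE)
  moreover have "finite (I \<rightarrow>\<^sub>E (UNIV :: 'a set))"
    using \<open>finite I\<close> by (simp add: finite_PiE)
  moreover have "?r ` C \<subseteq> I \<rightarrow>\<^sub>E UNIV"
    by auto
  ultimately have "?r ` C = I \<rightarrow>\<^sub>E UNIV"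
    by (metis card_image card_subset_eq)
  then obtain c where "c \<in> C" and "?r c = restrict f I"
    by (metis (no_types, lifting) UNIV_I imageE restrict_PiE_iff)
  thus thesis
    using that by (metis restrict_apply')
qed

section \<open>Conics in the projective plane\<close>

lemma scalar_prod_3:
  assumes "v \<in> carrier_vec 3"
  shows "a \<bullet> v = a $ 0 * v $ 0 + a $ 1 * v $ 1 + a $ 2 * v $ 2"
  using assms by (simp add: scalar_prod_def numeral_3_eq_3 numeral_2_eq_2)

lemma eq_vec_3_iff:
  assumes "v \<in> carrier_vec 3" and "w \<in> carrier_vec 3"
  shows "v = w \<longleftrightarrow> v $ 0 = w $ 0 \<and> v $ 1 = w $ 1 \<and> v $ 2 = w $ 2"
  using assms by (auto simp: vec_eq_iff less_Suc_eq numeral_3_eq_3 numeral_2_eq_2)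

definition vec3 :: "'a \<Rightarrow> 'a \<Rightarrow> 'a \<Rightarrow> 'a vec" where
  "vec3 a b c = vec 3 (\<lambda>i. [a, b, c] ! i)"

lemma vec3_simps [simp]:
  "vec3 a b c \<in> carrier_vec 3" "dim_vec (vec3 a b c) = 3"
  "vec3 a b c $ 0 = a" "vec3 a b c $ Suc 0 = b" "vec3 a b c $ 2 = c"
  by (simp_all add: vec3_def)

lemma vec3_eq_zero_iff: "vec3 a b c = 0\<^sub>v 3 \<longleftrightarrow> a = 0 \<and> b = 0 \<and> c = 0"
  by (simp add: eq_vec_3_iff)

lemma proj_point_eqD:
  fixes v :: "'a::field vec"
  assumes "proj_point v = proj_point w"
  obtains c where "v = c \<cdot>\<^sub>v w"
proof -
  have "v \<in> proj_point v"
    unfolding proj_point_def mem_Collect_eq by (rule exI[of _ 1]) simp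
  thus thesis
    using that unfolding assms unfolding proj_point_def by auto
qed

lemma proj_point_smult:
  fixes v :: "'a::field vec"
  assumes "c \<noteq> 0"
  shows "proj_point (c \<cdot>\<^sub>v v) = proj_point v"
proof
  show "proj_point (c \<cdot>\<^sub>v v) \<subseteq> proj_point v"
    by (auto simp: proj_point_def smult_smult_assoc)
  show "proj_point v \<subseteq> proj_point (c \<cdot>\<^sub>v v)"
  proof
    fix w
    assume "w \<in> proj_point v"
    then obtain b where "w = b \<cdot>\<^sub>v v"
      by (auto simp: proj_point_def)
    hence "w = (b / c) \<cdot>\<^sub>v (c \<cdot>\<^sub>v v)"
      using assms by (simp add: smult_smult_assoc)
    thus "w \<in> proj_point (c \<cdot>\<^sub>v v)"
      by (auto simp: proj_point_def)
  qed
qed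

lemma proj_point_eqI:
  fixes v :: "'a::field vec"
  assumes "v = c \<cdot>\<^sub>v w" and "c \<noteq> 0"
  shows "proj_point v = proj_point w"
  using assms by (simp add: proj_point_smult)

lemma proj_point_in_pg_points:
  assumes "v \<in> carrier_vec 3" and "v \<noteq> 0\<^sub>v 3"
  shows "proj_point v \<in> pg_points"
  using assms by (auto simp: pg_points_def)

lemma pg_pointsE:
  assumes "P \<in> pg_points"
  obtains v where "v \<in> carrier_vec 3" "v \<noteq> 0\<^sub>v 3" "P = proj_point v"
  using assms by (auto simp: pg_points_def)

text \<open>By linearity, incidence can be tested on a single coordinate vector.\<close>

lemma proj_point_in_pg_line_iff:
  fixes v :: "'a::field vec"
  assumes "v \<in> carrier_vec 3" and "v \<noteq> 0\<^sub>v 3" and "a \<in> carrier_vec 3"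
  shows "proj_point v \<in> pg_line a \<longleftrightarrow> a \<bullet> v = 0"
proof -
  have "a \<bullet> (c \<cdot>\<^sub>v v) = c * (a \<bullet> v)" for c
    using assms by simp
  moreover have "(\<forall>x\<in>proj_point v. a \<bullet> x = 0) \<longleftrightarrow> (\<forall>c. a \<bullet> (c \<cdot>\<^sub>v v) = 0)"
    by (auto simp: proj_point_def)
  ultimately have "(\<forall>x\<in>proj_point v. a \<bullet> x = 0) \<longleftrightarrow> a \<bullet> v = 0"
    by (auto dest: spec[of _ 1])
  thus ?thesis
    by (simp add: pg_line_def proj_point_in_pg_points assms)
qed

section \<open>The conic \<open>z\<^sup>2 = \<beta> * x * y\<close> and its nucleus\<close>

definition std_conic_mat :: "'a::field \<Rightarrow> 'a mat" where
  "std_conic_mat \<beta> =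
     mat 3 3 (\<lambda>(i, j). if i = 0 \<and> j = 1 then \<beta> else if i = 2 \<and> j = 2 then 1 else 0)"

lemma std_conic_mat_carrier [simp]: "std_conic_mat \<beta> \<in> carrier_mat 3 3"
  by (simp add: std_conic_mat_def)

lemma quad_form_std_conic_mat:
  assumes "v \<in> carrier_vec 3"
  shows "quad_form (std_conic_mat \<beta>) v = \<beta> * v $ 0 * v $ 1 + (v $ 2)\<^sup>2"
proof -
  have "(std_conic_mat \<beta> *\<^sub>v v) $ i = (if i = 0 then \<beta> * v $ 1 else if i = 2 then v $ 2 else 0)"
    if "i < 3" for i
  proof -
    have "(std_conic_mat \<beta> *\<^sub>v v) $ i = row (std_conic_mat \<beta>) i \<bullet> v"
      using that by (simp add: std_conic_mat_def)
    thus ?thesis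
      using that assms
      by (auto simp: scalar_prod_3 std_conic_mat_def less_Suc_eq numeral_3_eq_3)
  qed
  moreover have "std_conic_mat \<beta> *\<^sub>v v \<in> carrier_vec 3"
    using std_conic_mat_carrier assms by (rule mult_mat_vec_carrier)
  ultimately show ?thesis
    by (simp add: quad_form_def scalar_prod_3 power2_eq_square)
qed

text \<open>The square term contributes a double, which vanishes, so only the mixed term is
  left.\<close>

lemma polar_form_std_conic_mat:
  assumes "(2::'a::field) = 0" and "v \<in> carrier_vec 3" and "w \<in> carrier_vec 3"
  shows "polar_form (std_conic_mat \<beta>) v w = \<beta> * (v $ 0 * w $ 1 + v $ 1 * w $ 0 :: 'a)"
proof -
  have "v + w \<in> carrier_vec 3"
    using assms by simp
  thus ?thesis
    unfolding polar_form_def using assms(2,3)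
    by (simp add: quad_form_std_conic_mat)
       (rule eq_mod_two[OF assms(1), of _ _ "v $ 2 * w $ 2"],
        simp add: power2_eq_square algebra_simps)
qed

text \<open>The radical of the polar form is spanned by (0, 0, 1); there the form is the square of
  the last coordinate, which vanishes only at zero.\<close>

lemma nondegenerate_std_conic_mat:
  assumes "(2::'a::field) = 0" and "\<beta> \<noteq> (0::'a)"
  shows "nondegenerate_form (std_conic_mat \<beta>)"
  unfolding nondegenerate_form_def
proof (intro ballI impI)
  fix v :: "'a vec"
  assume v: "v \<in> carrier_vec 3"
    and *: "(\<forall>u\<in>carrier_vec 3. polar_form (std_conic_mat \<beta>) v u = 0)
      \<and> quad_form (std_conic_mat \<beta>) v = 0"
  have polar: "polar_form (std_conic_mat \<beta>) v u = 0" if "u \<in> carrier_vec 3" for u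
    using * that by blast
  have quad: "\<beta> * v $ 0 * v $ 1 + (v $ 2)\<^sup>2 = 0"
    using * v by (simp add: quad_form_std_conic_mat)
  have "v $ 0 = 0" "v $ 1 = 0"
    using polar[of "vec3 0 1 0"] polar[of "vec3 1 0 0"] assms v
    by (simp_all add: polar_form_std_conic_mat)
  thus "v = 0\<^sub>v 3"
    using quad v by (simp add: eq_vec_3_iff)
qed

lemma proj_point_in_std_conic_iff:
  fixes v :: "'a::field vec"
  assumes "(2::'a) = 0" and v: "v \<in> carrier_vec 3" "v \<noteq> 0\<^sub>v 3"
  shows "proj_point v \<in> conic (std_conic_mat \<beta>) \<longleftrightarrow> (v $ 2)\<^sup>2 = \<beta> * v $ 0 * v $ 1"
proof -
  have "quad_form (std_conic_mat \<beta>) (c \<cdot>\<^sub>v v) = c\<^sup>2 * quad_form (std_conic_mat \<beta>) v" for c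
    using v by (simp add: quad_form_std_conic_mat power2_eq_square algebra_simps)
  moreover have "(\<forall>x\<in>proj_point v. quad_form (std_conic_mat \<beta>) x = 0)
      \<longleftrightarrow> (\<forall>c. quad_form (std_conic_mat \<beta>) (c \<cdot>\<^sub>v v) = 0)"
    by (auto simp: proj_point_def)
  ultimately have "(\<forall>x\<in>proj_point v. quad_form (std_conic_mat \<beta>) x = 0)
      \<longleftrightarrow> quad_form (std_conic_mat \<beta>) v = 0"
    by (auto dest: spec[of _ 1])
  also have "\<dots> \<longleftrightarrow> (v $ 2)\<^sup>2 = \<beta> * v $ 0 * v $ 1"
    using v add_eq_zero_iff_eq[OF assms(1)] by (auto simp: quad_form_std_conic_mat)
  finally show ?thesis
    by (simp add: conic_def proj_point_in_pg_points v)
qed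

text \<open>Rational parametrisation, used to bound the number of points. If \<open>y = 0\<close>
  then \<open>z = 0\<close>, leaving one point; otherwise scale to \<open>y = 1\<close>, and
  \<open>z = t\<close> determines \<open>x\<close>.\<close>

lemma std_conic_subset:
  fixes \<beta> :: "'a::field"
  assumes two: "(2::'a) = 0" and "\<beta> \<noteq> 0"
  shows "conic (std_conic_mat \<beta>)
    \<subseteq> insert (proj_point (vec3 1 0 0)) (range (\<lambda>t. proj_point (vec3 (t\<^sup>2 / \<beta>) 1 t)))"
proof
  fix P
  assume P: "P \<in> conic (std_conic_mat \<beta>)"
  hence "P \<in> pg_points"
    by (simp add: conic_def)
  then obtain v where v: "v \<in> carrier_vec 3" "v \<noteq> 0\<^sub>v 3" and P_eq: "P = proj_point v"
    by (rule pg_pointsE)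
  have eq: "(v $ 2)\<^sup>2 = \<beta> * v $ 0 * v $ 1"
    using P P_eq proj_point_in_std_conic_iff[OF two v] by simp
  show "P \<in> insert (proj_point (vec3 1 0 0)) (range (\<lambda>t. proj_point (vec3 (t\<^sup>2 / \<beta>) 1 t)))"
  proof (cases "v $ 1 = 0")
    case True
    hence "v = v $ 0 \<cdot>\<^sub>v vec3 1 0 0" and "v $ 0 \<noteq> 0"
      using eq v by (auto simp: eq_vec_3_iff)
    hence "P = proj_point (vec3 1 0 0)"
      unfolding P_eq by (rule proj_point_eqI)
    thus ?thesis
      by simp
  next
    case False
    define t where "t = v $ 2 / v $ 1"
    have "t\<^sup>2 / \<beta> * v $ 1 = v $ 0"
      unfolding t_def power_divide eq using False assms by (simp add: power2_eq_square)
    hence "v = v $ 1 \<cdot>\<^sub>v vec3 (t\<^sup>2 / \<beta>) 1 t"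
      using False v by (simp add: eq_vec_3_iff t_def mult.commute)
    hence "P = proj_point (vec3 (t\<^sup>2 / \<beta>) 1 t)"
      unfolding P_eq using False by (rule proj_point_eqI)
    thus ?thesis by blast
  qed
qed

lemma
  fixes \<beta> :: "'a::{field,finite}"
  assumes "(2::'a) = 0" and "\<beta> \<noteq> 0"
  shows finite_std_conic: "finite (conic (std_conic_mat \<beta>))"
    and card_std_conic_le: "card (conic (std_conic_mat \<beta>)) \<le> CARD('a) + 1"
proof -
  let ?R = "range (\<lambda>t. proj_point (vec3 (t\<^sup>2 / \<beta>) 1 t))"
  show "finite (conic (std_conic_mat \<beta>))"
    by (rule finite_subset[OF std_conic_subset[OF assms]]) auto
  have "card (conic (std_conic_mat \<beta>)) \<le> card (insert (proj_point (vec3 1 0 0)) ?R)"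
    by (rule card_mono[OF _ std_conic_subset[OF assms]]) auto
  also have "\<dots> \<le> Suc (card ?R)"
    by (rule card_insert_le_m1) auto
  also have "card ?R \<le> CARD('a)"
    by (rule card_image_le) simp
  finally show "card (conic (std_conic_mat \<beta>)) \<le> CARD('a) + 1"
    by simp
qed

text \<open>A line avoiding (0, 0, 1), that is with \<open>a2\<close> nonzero, cannot be tangent:
  from one common point with the conic a second, non-proportional one is built explicitly.\<close>

lemma std_conic_second_point:
  fixes \<beta> :: "'a::field"
  assumes two: "(2::'a) = 0" and "\<beta> \<noteq> 0" and "a2 \<noteq> 0" and "(x, y, z) \<noteq> (0, 0, 0)"
    and conic: "z\<^sup>2 = \<beta> * x * y" and line: "a0 * x + a1 * y + a2 * z = 0"
  obtains x' y' z' where "(x', y', z') \<noteq> (0, 0, 0)"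
    and "z'\<^sup>2 = \<beta> * x' * y'" and "a0 * x' + a1 * y' + a2 * z' = 0"
    and "\<And>c. (x', y', z') \<noteq> (c * x, c * y, c * z)"
proof -
  consider (a0) "a0 = 0" "y = 0" | (a0') "a0 = 0" "y \<noteq> 0" | (a1) "a0 \<noteq> 0" "a1 = 0" "x = 0"
    | (a1') "a0 \<noteq> 0" "a1 = 0" "x \<noteq> 0" | (both) "a0 \<noteq> 0" "a1 \<noteq> 0"
    by blast
  thus thesis
  proof cases
    case a0
    show thesis
    \<comment> \<open>The given point is (1, 0, 0) up to scaling. The witness solves
      \<open>a1 * y + a2 * z = 0\<close> with \<open>y\<close> nonzero, and the conic equation then
      fixes its first coordinate.\<close>
    proof (rule that[of "a1\<^sup>2" "\<beta> * a2\<^sup>2" "\<beta> * a1 * a2"])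
      show "a0 * a1\<^sup>2 + a1 * (\<beta> * a2\<^sup>2) + a2 * (\<beta> * a1 * a2) = 0"
        by (rule eq_mod_two[OF two, of _ _ "\<beta> * a1 * a2 * a2"])
           (simp add: a0 power2_eq_square algebra_simps)
    qed (use assms(2,3) a0 in \<open>auto simp: power2_eq_square\<close>)
  next
    case a0'
    show thesis
      \<comment> \<open>This point lies on the line since \<open>a0 = 0\<close>, and differs from
        the given one, whose \<open>y\<close> is nonzero.\<close>
      by (rule that[of 1 0 0]) (use a0' in auto)
  next
    case a1
    show thesis
    \<comment> \<open>The first case with the roles of \<open>x\<close> and \<open>y\<close>
      exchanged.\<close>
    proof (rule that[of "\<beta> * a2\<^sup>2" "a0\<^sup>2" "\<beta> * a0 * a2"])
      show "a0 * (\<beta> * a2\<^sup>2) + a1 * a0\<^sup>2 + a2 * (\<beta> * a0 * a2) = 0"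
        by (rule eq_mod_two[OF two, of _ _ "\<beta> * a0 * a2 * a2"])
           (simp add: a1 power2_eq_square algebra_simps)
    qed (use assms(2,3) a1 in \<open>auto simp: power2_eq_square\<close>)
  next
    case a1'
    show thesis
      by (rule that[of 0 1 0]) (use a1' in auto)
  next
    case both
    have "x = 0 \<and> y = 0 \<and> z = 0" if "x * y = 0"
    proof -
      have "z = 0"
        using conic that by (simp add: mult.assoc)
      thus ?thesis
        using that line both by auto
    qed
    hence "x * y \<noteq> 0"
      using assms(4) by blast
    hence nz: "x \<noteq> 0" "y \<noteq> 0" "z \<noteq> 0"
      using conic \<open>\<beta> \<noteq> 0\<close> by auto
    \<comment> \<open>this involution preserves both the conic and the line\<close>
    show thesis
    proof (rule that[of "a1\<^sup>2 * y" "a0\<^sup>2 * x" "a0 * a1 * z"])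
      show "(a0 * a1 * z)\<^sup>2 = \<beta> * (a1\<^sup>2 * y) * (a0\<^sup>2 * x)"
        unfolding power_mult_distrib conic by simp
      have "a0 * (a1\<^sup>2 * y) + a1 * (a0\<^sup>2 * x) + a2 * (a0 * a1 * z)
          = a0 * a1 * (a0 * x + a1 * y + a2 * z)"
        by (simp add: power2_eq_square algebra_simps)
      thus "a0 * (a1\<^sup>2 * y) + a1 * (a0\<^sup>2 * x) + a2 * (a0 * a1 * z) = 0"
        using line by simp
      show "(a1\<^sup>2 * y, a0\<^sup>2 * x, a0 * a1 * z) \<noteq> (0, 0, 0)"
        using nz both by simp
      fix c
      show "(a1\<^sup>2 * y, a0\<^sup>2 * x, a0 * a1 * z) \<noteq> (c * x, c * y, c * z)"
      proof
        assume "(a1\<^sup>2 * y, a0\<^sup>2 * x, a0 * a1 * z) = (c * x, c * y, c * z)"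
        \<comment> \<open>The last coordinates force \<open>c = a0 * a1\<close>, as \<open>z\<close>
          is nonzero.\<close>
        hence "a1\<^sup>2 * y = a0 * a1 * x"
          using nz by auto
        hence "a1 * y = a0 * x"
          using both by (simp add: power2_eq_square)
        hence "a2 * z = 0"
          using line add_self_eq_zero[OF two, of "a0 * x"] by simp
        thus False
          using nz assms by simp
      qed
    qed
  qed
qed

text \<open>By \<open>std_conic_second_point\<close> a line meeting the conic exactly once has last
  coefficient 0, which says that it passes through (0, 0, 1).\<close>

lemma nucleus_std_conic:
  fixes \<beta> :: "'a::field"
  assumes two: "(2::'a) = 0" and "\<beta> \<noteq> 0"
  shows "nucleus (conic (std_conic_mat \<beta>)) (proj_point (vec3 0 0 1))"
  unfolding nucleus_def
proof (intro conjI allI impI)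
  show "proj_point (vec3 0 0 1) \<in> (pg_points :: 'a vec set set)"
    by (intro proj_point_in_pg_points) (simp_all add: vec3_eq_zero_iff)
next
  fix L
  let ?K = "conic (std_conic_mat \<beta>)"
  assume "tangent_line ?K L"
  then obtain a where a: "a \<in> carrier_vec 3" and L: "L = pg_line a" and "card (L \<inter> ?K) = 1"
    by (auto simp: tangent_line_def pg_lines_def)
  then obtain P where P: "L \<inter> ?K = {P}"
    by (auto simp: card_1_singleton_iff)
  hence "P \<in> pg_points"
    by (auto simp: conic_def)
  then obtain v where v: "v \<in> carrier_vec 3" "v \<noteq> 0\<^sub>v 3" and P_eq: "P = proj_point v"
    by (rule pg_pointsE)
  have conic: "(v $ 2)\<^sup>2 = \<beta> * v $ 0 * v $ 1"
    using P P_eq proj_point_in_std_conic_iff[OF two v] by blast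
  have "proj_point v \<in> pg_line a"
    using P P_eq L by blast
  hence line: "a $ 0 * v $ 0 + a $ 1 * v $ 1 + a $ 2 * v $ 2 = 0"
    using proj_point_in_pg_line_iff[OF v a] scalar_prod_3[OF v(1)] by simp
  have nz: "(v $ 0, v $ 1, v $ 2) \<noteq> (0, 0, 0)"
    using v by (auto simp: eq_vec_3_iff)
  have "a $ 2 = 0"
  proof (rule ccontr)
    assume "a $ 2 \<noteq> 0"
    from std_conic_second_point[OF two \<open>\<beta> \<noteq> 0\<close> this nz conic line]
    obtain x y z where w: "(x, y, z) \<noteq> (0, 0, 0)" "z\<^sup>2 = \<beta> * x * y"
      "a $ 0 * x + a $ 1 * y + a $ 2 * z = 0"
      and ne: "\<And>c. (x, y, z) \<noteq> (c * v $ 0, c * v $ 1, c * v $ 2)"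
      by metis
    have w_nz: "vec3 x y z \<noteq> 0\<^sub>v 3"
      using w(1) by (auto simp: vec3_eq_zero_iff)
    have "proj_point (vec3 x y z) \<in> L \<inter> ?K"
      using w w_nz a two
      by (simp add: L proj_point_in_pg_line_iff proj_point_in_std_conic_iff scalar_prod_3)
    hence "proj_point (vec3 x y z) = proj_point v"
      using P P_eq by simp
    then obtain c where "vec3 x y z = c \<cdot>\<^sub>v v"
      by (rule proj_point_eqD)
    hence "(x, y, z) = (c * v $ 0, c * v $ 1, c * v $ 2)"
      using v(1) by (simp add: eq_vec_3_iff)
    thus False
      using ne by blast
  qed
  thus "proj_point (vec3 0 0 1) \<in> L"
    using a by (simp add: L proj_point_in_pg_line_iff scalar_prod_3 vec3_eq_zero_iff)
qed

section \<open>Extended cyclic codes\<close>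

lemma sum_cyclic_shift:
  fixes f :: "nat \<Rightarrow> 'a::comm_monoid_add"
  shows "(\<Sum>j<n. f ((j + 1) mod n)) = (\<Sum>j<n. f j)"
proof (cases n)
  case (Suc k)
  have "(\<Sum>j<Suc k. f ((j + 1) mod Suc k)) = (\<Sum>j<k. f (Suc j)) + f 0"
    by simp
  also have "\<dots> = (\<Sum>j<Suc k. f j)"
    by (simp only: sum.lessThan_Suc_shift add.commute)
  finally show ?thesis
    using Suc by simp
qed simp

text \<open>Shifting the first \<open>n\<close> coordinates preserves their sum, so the extended
  code is invariant under the shift that fixes the check coordinate.\<close>

lemma
  fixes E :: "'a::field vec set"
  assumes "extended_cyclic_code E" and lin: "linear_code (Suc n) E" and "c \<in> E"
  shows extended_cyclic_code_parity: "c $ n = - (\<Sum>j<n. c $ j)"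
    and extended_cyclic_code_shift:
      "vec (Suc n) (\<lambda>i. if i < n then c $ ((i + 1) mod n) else c $ n) \<in> E"
proof -
  obtain k C where cyclic: "cyclic_code k C" and E: "E = extended_code k C"
    using assms(1) by (auto simp: extended_cyclic_code_def)
  \<comment> \<open>The length hidden in \<open>extended_cyclic_code\<close> is recovered from the
    length of the word \<open>c\<close>.\<close>
  have "dim_vec c = k + 1" "dim_vec c = Suc n"
    using \<open>c \<in> E\<close> linear_codeD(1)[OF lin] by (auto simp: E extended_code_def)
  hence [simp]: "k = n" by simp
  obtain d where "d \<in> C"
    and c: "c = vec (n + 1) (\<lambda>i. if i < n then d $ i else - (\<Sum>j<n. d $ j))"
    using \<open>c \<in> E\<close> by (auto simp: E extended_code_def)
  thus parity: "c $ n = - (\<Sum>j<n. c $ j)"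
    by simp
  have "cyclic_shift n d \<in> C"
    using cyclic \<open>d \<in> C\<close> by (simp add: cyclic_code_def)
  moreover have "(\<Sum>j<n. cyclic_shift n d $ j) = (\<Sum>j<n. d $ j)"
    using sum_cyclic_shift[of "($) d" n] by (simp add: cyclic_shift_def)
  moreover have "c $ ((i + 1) mod n) = d $ ((i + 1) mod n)" if "i < n" for i
    using that mod_less_divisor[of n "i + 1"] by (simp add: c del: mod_less_divisor)
  hence "vec (Suc n) (\<lambda>i. if i < n then c $ ((i + 1) mod n) else c $ n)
      = vec (n + 1) (\<lambda>i. if i < n then cyclic_shift n d $ i else - (\<Sum>j<n. d $ j))"
    by (intro eq_vecI) (auto simp: cyclic_shift_def c)
  ultimately show "vec (Suc n) (\<lambda>i. if i < n then c $ ((i + 1) mod n) else c $ n) \<in> E"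
    unfolding E extended_code_def by (intro image_eqI) auto
qed

lemma code_equiv_refl:
  assumes "linear_code n C"
  shows "code_equiv n C C"
proof -
  have "vec n (\<lambda>i. 1 * c $ id i) = c" if "c \<in> C" for c
    using linear_codeD(1)[OF assms] that by (intro eq_vecI) auto
  hence "C = (\<lambda>c. vec n (\<lambda>i. 1 * c $ id i)) ` C"
    by simp
  thus ?thesis
    unfolding code_equiv_def
    by (intro exI[of _ id] exI[of _ "\<lambda>_. 1"]) (simp add: permutes_id)
qed

section \<open>A systematic generator matrix of the code\<close>

locale extended_cyclic_hyperoval_code =
  fixes E :: "'a::{field,finite} vec set" and m q :: nat
  assumes m: "m \<ge> 1" and q: "q = 2 ^ m" and card_field: "CARD('a) = q"
    and ext: "extended_cyclic_code E"
    and params: "code_params (q + 2) 3 q E"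
begin

abbreviation "n \<equiv> q + 1"

lemma two: "(2::'a) = 0"
  using two_eq_zero_of_card_power_two card_field q by blast

lemma q_ge_2: "q \<ge> 2"
  using m q power_increasing[of 1 m "2::nat"] by simp

lemma lin: "linear_code (q + 2) E"
  using params by (simp add: code_params_def)

lemma carrier: "E \<subseteq> carrier_vec (q + 2)"
  using linear_codeD(1)[OF lin] .

lemma params': "code_params (q + 2) 3 (q + 2 - 3 + 1) E"
proof -
  have "q + 2 - 3 + 1 = q"
    using q_ge_2 by simp
  thus ?thesis
    using params by (simp only:)
qed

lemma mds: "mds_code (q + 2) E"
  unfolding mds_code_def using params' by blast

lemma word_eqI:
  assumes "c \<in> E" "d \<in> E" and "i < q + 2" "j < q + 2" "k < q + 2"
    and "i \<noteq> j" "i \<noteq> k" "j \<noteq> k" and "c $ i = d $ i" "c $ j = d $ j" "c $ k = d $ k"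
  shows "c = d"
  by (rule code_word_eqI[OF params, of "{i, j, k}"]) (use assms in auto)

lemma interpolation:
  assumes "i < q + 2" "j < q + 2" "k < q + 2" and "i \<noteq> j" "i \<noteq> k" "j \<noteq> k"
  obtains c where "c \<in> E" "c $ i = r" "c $ j = s" "c $ k = t"
proof -
  from assms have "{i, j, k} \<subseteq> {..<q + 2}" and "card {i, j, k} = 3"
    by auto
  from mds_code_interpolation[OF params' this,
      of "\<lambda>l. if l = i then r else if l = j then s else t"]
  obtain c where c: "c \<in> E"
    "\<And>l. l \<in> {i, j, k} \<Longrightarrow> c $ l = (if l = i then r else if l = j then s else t)"
    by blast
  from c(2)[of i] c(2)[of j] c(2)[of k] show thesis
    using that[OF c(1)] assms(4-6) by simp
qed

text \<open>The basis of the code dual to two adjacent coordinates and the check coordinate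
  \<open>n\<close>; these words are the rows of the generator matrix.\<close>

definition x where "x = (SOME c. c \<in> E \<and> c $ 0 = 1 \<and> c $ 1 = 0 \<and> c $ n = 0)"
definition y where "y = (SOME c. c \<in> E \<and> c $ 0 = 0 \<and> c $ 1 = 1 \<and> c $ n = 0)"
definition z where "z = (SOME c. c \<in> E \<and> c $ 0 = 0 \<and> c $ 1 = 0 \<and> c $ n = 1)"

lemma interpolation_01n: "\<exists>c. c \<in> E \<and> c $ 0 = r \<and> c $ 1 = s \<and> c $ n = t"
proof -
  have "0 < q + 2" "1 < q + 2" "n < q + 2" "0 \<noteq> (1::nat)" "0 \<noteq> n" "1 \<noteq> n"
    using q_ge_2 by simp_all
  from interpolation[OF this] show ?thesis
    by metis
qed

lemma
  shows x: "x \<in> E" "x $ 0 = 1" "x $ Suc 0 = 0" "x $ n = 0"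
    and y: "y \<in> E" "y $ 0 = 0" "y $ Suc 0 = 1" "y $ n = 0"
    and z: "z \<in> E" "z $ 0 = 0" "z $ Suc 0 = 0" "z $ n = 1"
  using someI_ex[OF interpolation_01n[of 1 0 0]] someI_ex[OF interpolation_01n[of 0 1 0]]
    someI_ex[OF interpolation_01n[of 0 0 1]]
  by (simp_all add: x_def y_def z_def)

lemma dims: "dim_vec x = q + 2" "dim_vec y = q + 2" "dim_vec z = q + 2"
  using x(1) y(1) z(1) carrier by auto

definition word :: "'a vec \<Rightarrow> 'a vec" where
  "word a = a $ 0 \<cdot>\<^sub>v x + a $ 1 \<cdot>\<^sub>v y + a $ 2 \<cdot>\<^sub>v z"

definition column :: "nat \<Rightarrow> 'a vec" where
  "column j = vec3 (x $ j) (y $ j) (z $ j)"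

lemma column_carrier [simp]: "column j \<in> carrier_vec 3"
  by (simp add: column_def)

lemma word_in: "word a \<in> E"
  unfolding word_def using x y z by (intro linear_codeD(3,4)[OF lin])

lemma word_index:
  assumes "j < q + 2"
  shows "word a $ j = a \<bullet> column j"
  using assms dims by (simp add: word_def column_def scalar_prod_3)

lemma column_01n: "column 0 = vec3 1 0 0" "column 1 = vec3 0 1 0" "column n = vec3 0 0 1"
  using x y z by (simp_all add: column_def)

lemma word_at_01n: "word a $ 0 = a $ 0" "word a $ 1 = a $ 1" "word a $ n = a $ 2"
proof -
  show "word a $ 0 = a $ 0" "word a $ 1 = a $ 1" "word a $ n = a $ 2"
    using word_index[of 0 a] word_index[of 1 a] word_index[of n a] unfolding column_01n
    by (simp_all add: scalar_prod_3)
qed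

text \<open>Both sides agree at 0, 1 and \<open>n\<close>, and three coordinates determine a
  word.\<close>

lemma word_eq:
  assumes "c \<in> E"
  shows "c = word (vec3 (c $ 0) (c $ 1) (c $ n))"
  using word_at_01n[of "vec3 (c $ 0) (c $ 1) (c $ n)"] q_ge_2 assms word_in
  by (intro word_eqI[of _ _ 0 1 n]) simp_all

lemma word_index_eq:
  assumes "c \<in> E" and "j < q + 2"
  shows "c $ j = c $ 0 * x $ j + c $ 1 * y $ j + c $ n * z $ j"
  using arg_cong[OF word_eq[OF assms(1)], of "\<lambda>c. c $ j"] assms(2)
  by (simp add: word_index scalar_prod_3 column_def)

text \<open>The source of the recurrence: the shifted word is again a codeword, so it expands in
  \<open>x\<close>, \<open>y\<close>, \<open>z\<close> by its own entries at 0, 1 and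
  \<open>n\<close>. Reducing indices modulo \<open>n\<close> covers the wrap-around.\<close>

lemma shift_index_eq:
  assumes "c \<in> E"
  shows "c $ (Suc i mod n) = c $ 1 * x $ (i mod n) + c $ 2 * y $ (i mod n) + c $ n * z $ (i mod n)"
proof -
  define d where "d = vec (Suc n) (\<lambda>i. if i < n then c $ ((i + 1) mod n) else c $ n)"
  have "d \<in> E"
    unfolding d_def by (rule extended_cyclic_code_shift[OF ext _ assms]) (use lin in simp)
  moreover have "i mod n < n"
    by simp
  ultimately have "d $ (i mod n) = d $ 0 * x $ (i mod n) + d $ 1 * y $ (i mod n) + d $ n * z $ (i mod n)"
    by (intro word_index_eq) linarith+
  moreover have "d $ (i mod n) = c $ (Suc i mod n)"
    using \<open>i mod n < n\<close> by (simp add: d_def mod_Suc_eq del: mod_less_divisor)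
  \<comment> \<open>Since \<open>n\<close> is at least 3, the indices 1 and 2 do not wrap
    around.\<close>
  moreover have "d $ 0 = c $ 1" "d $ 1 = c $ 2" "d $ n = c $ n"
    using q_ge_2 by (simp_all add: d_def numeral_2_eq_2)
  ultimately show ?thesis
    by simp
qed

lemma parity:
  assumes "c \<in> E"
  shows "(\<Sum>i<n. c $ (i mod n)) = c $ n"
proof -
  have "c $ n = - (\<Sum>i<n. c $ i)"
    by (rule extended_cyclic_code_parity[OF ext _ assms]) (use lin in simp)
  also have "\<dots> = (\<Sum>i<n. c $ i)"
    by (rule uminus_eq_self[OF two])
  also have "\<dots> = (\<Sum>i<n. c $ (i mod n))"
    by (intro sum.cong) simp_all
  finally show ?thesis ..
qed

abbreviation "\<beta> \<equiv> y $ 2"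

text \<open>Otherwise \<open>y\<close> vanishes at the three coordinates 0, 2 and \<open>n\<close>,
  hence everywhere.\<close>

lemma beta_nonzero: "\<beta> \<noteq> 0"
proof
  assume "\<beta> = 0"
  hence "y = 0\<^sub>v (q + 2)"
    using q_ge_2 y linear_codeD(2)[OF lin] by (intro word_eqI[of _ _ 0 2 n]) simp_all
  thus False
    using y(3) by simp
qed

sublocale shift_recurrence "\<lambda>i. x $ (i mod n)" "\<lambda>i. y $ (i mod n)" "\<lambda>i. z $ (i mod n)"
  "x $ 2" \<beta> "z $ 2" n
proof
  show "odd n"
    using m q by simp
  show "(x $ 2) ^ n = (x $ 2)\<^sup>2" if "x $ 2 \<noteq> 0"
  proof -
    \<comment> \<open>Splits off the exponent \<open>q - 1\<close>, whose power is 1.\<close>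
    have "n = q - 1 + 2"
      using q_ge_2 by simp
    hence "(x $ 2) ^ n = (x $ 2) ^ (q - 1) * (x $ 2)\<^sup>2"
      by (simp only: power_add)
    thus ?thesis
      using power_card_minus_one[OF that] card_field by simp
  qed
  show "x $ (Suc i mod n) = x $ 2 * y $ (i mod n)" for i
    unfolding shift_index_eq[OF x(1)] using x by simp
  show "y $ (Suc i mod n) = x $ (i mod n) + \<beta> * y $ (i mod n)" for i
    unfolding shift_index_eq[OF y(1)] using y by simp
  show "z $ (Suc i mod n) = z $ (i mod n) + z $ 2 * y $ (i mod n)" for i
    unfolding shift_index_eq[OF z(1)] using z by simp
  show "(\<Sum>i<n. x $ (i mod n)) = 0" "(\<Sum>i<n. y $ (i mod n)) = 0"
    "(\<Sum>i<n. z $ (i mod n)) = 1"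
    unfolding parity[OF x(1)] parity[OF y(1)] parity[OF z(1)] by (rule x y z)+
qed (simp_all add: two beta_nonzero x y z)

text \<open>Any three columns are linearly independent: a relation \<open>a\<close> yields a
  codeword with three zeros.\<close>

lemma column_eq_zeroI:
  assumes "a \<in> carrier_vec 3" and "i < q + 2" "j < q + 2" "k < q + 2"
    and "i \<noteq> j" "i \<noteq> k" "j \<noteq> k"
    and "a \<bullet> column i = 0" "a \<bullet> column j = 0" "a \<bullet> column k = 0"
  shows "a = 0\<^sub>v 3"
proof -
  have "word a = 0\<^sub>v (q + 2)"
    using assms word_in linear_codeD(2)[OF lin]
    by (intro word_eqI[of _ _ i j k]) (simp_all add: word_index)
  thus ?thesis
    using word_at_01n[of a] assms(1) by (simp add: eq_vec_3_iff)
qed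

text \<open>Interpolate 1 at \<open>i\<close> and 0 at \<open>j\<close>; the coordinates of that
  word in the basis form the functional \<open>a\<close>.\<close>

lemma column_separation:
  assumes "i < q + 2" "j < q + 2" "i \<noteq> j"
  obtains a where "a \<in> carrier_vec 3" "a \<bullet> column i = 1" "a \<bullet> column j = 0"
proof -
  \<comment> \<open>Interpolation prescribes three values, so an arbitrary third coordinate is
    chosen.\<close>
  obtain k where "k < q + 2" "i \<noteq> k" "j \<noteq> k"
  proof -
    have "{0, 1, 2} - {i, j} \<noteq> ({} :: nat set)"
      by (cases "i = 0"; cases "i = 1"; cases "j = 0"; cases "j = 1") auto
    thus thesis
      using that q_ge_2 by fastforce
  qed
  with assms obtain c where "c \<in> E" "c $ i = 1" "c $ j = 0"
    using interpolation[of i j k 1 0 0] by metis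
  thus thesis
    using that[of "vec3 (c $ 0) (c $ 1) (c $ n)"] word_eq[of c] assms word_index
    by (metis vec3_simps(1))
qed

lemma column_nonzero:
  assumes "j < q + 2"
  shows "column j \<noteq> 0\<^sub>v 3"
proof
  assume *: "column j = 0\<^sub>v 3"
  obtain i where "i < q + 2" "j \<noteq> i"
    using q_ge_2 that[of 0] that[of 1] by force
  with assms obtain a where "a \<in> carrier_vec 3" "a \<bullet> column j = 1"
    using column_separation by metis
  thus False
    using * by simp
qed

section \<open>The columns as points of a regular hyperoval\<close>

abbreviation "point j \<equiv> proj_point (column j)"

lemma inj_on_point: "inj_on point {..<q + 2}"
proof (rule inj_onI, rule ccontr)
  fix i j
  assume "i \<in> {..<q + 2}" "j \<in> {..<q + 2}" "i \<noteq> j" and eq: "point i = point j"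
  then obtain a where a: "a \<in> carrier_vec 3" "a \<bullet> column i = 1" "a \<bullet> column j = 0"
    using column_separation[of i j] by auto
  obtain c where "column i = c \<cdot>\<^sub>v column j"
    using eq by (rule proj_point_eqD)
  thus False
    using a by simp
qed

lemma card_points: "card (point ` {..<q + 2}) = q + 2"
  using card_image[OF inj_on_point] by simp

text \<open>A line through three of the points would be a nonzero functional vanishing on three
  columns.\<close>

lemma hyperoval_points: "hyperoval (point ` {..<q + 2})"
  unfolding hyperoval_def
proof (intro conjI ballI impI)
  show "point ` {..<q + 2} \<subseteq> pg_points"
    using column_nonzero by (auto intro!: proj_point_in_pg_points)
  show "card (point ` {..<q + 2}) = CARD('a) + 2"
    by (simp only: card_points card_field)
  fix P Q R
  assume "P \<in> point ` {..<q + 2}" "Q \<in> point ` {..<q + 2}" "R \<in> point ` {..<q + 2}"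
    and ne: "P \<noteq> Q \<and> P \<noteq> R \<and> Q \<noteq> R"
  then obtain i j k where ijk: "i < q + 2" "j < q + 2" "k < q + 2"
    and PQR: "P = point i" "Q = point j" "R = point k"
    by auto
  show "\<not> pg_collinear P Q R"
  proof
    assume "pg_collinear P Q R"
    then obtain a where a: "a \<in> carrier_vec 3" "a \<noteq> 0\<^sub>v 3"
      and "P \<in> pg_line a" "Q \<in> pg_line a" "R \<in> pg_line a"
      by (auto simp: pg_collinear_def pg_lines_def)
    hence "a \<bullet> column i = 0" "a \<bullet> column j = 0" "a \<bullet> column k = 0"
      using ijk by (simp_all add: PQR proj_point_in_pg_line_iff column_nonzero)
    moreover have "i \<noteq> j" "i \<noteq> k" "j \<noteq> k"
      using ne PQR by auto
    ultimately show False
      using column_eq_zeroI[OF a(1) ijk] a(2) by simp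
  qed
qed

text \<open>The first \<open>q + 1\<close> points are distinct and lie on a conic with at most
  \<open>q + 1\<close> points, so they exhaust it; the check coordinate supplies the
  nucleus.\<close>

lemma points_eq: "point ` {..<q + 2} = insert (proj_point (vec3 0 0 1)) (conic (std_conic_mat \<beta>))"
proof -
  have "point ` {..<n} \<subseteq> conic (std_conic_mat \<beta>)"
  proof
    fix P
    assume "P \<in> point ` {..<n}"
    then obtain j where j: "j < n" and P: "P = point j"
      by auto
    have "(z $ j)\<^sup>2 = \<beta> * x $ j * y $ j"
      using on_conic[of j] j by simp
    thus "P \<in> conic (std_conic_mat \<beta>)"
      using j column_nonzero[of j] two
      by (simp add: P proj_point_in_std_conic_iff) (simp add: column_def)
  qed
  moreover have "card (point ` {..<n}) = n"
    using card_image[OF inj_on_subset[OF inj_on_point, of "{..<n}"]] by simp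
  ultimately have "point ` {..<n} = conic (std_conic_mat \<beta>)"
    using finite_std_conic[OF two beta_nonzero] card_std_conic_le[OF two beta_nonzero] card_field
    by (intro card_seteq) simp_all
  moreover have "{..<q + 2} = insert n {..<n}"
    by auto
  ultimately show ?thesis
    by (simp only: image_insert column_01n)
qed

lemma regular_hyperoval_points: "regular_hyperoval (point ` {..<q + 2})"
proof -
  have "nondegenerate_conic (conic (std_conic_mat \<beta>))"
    unfolding nondegenerate_conic_def
    by (rule bexI[of _ "std_conic_mat \<beta>"])
       (simp_all add: nondegenerate_std_conic_mat two beta_nonzero)
  thus ?thesis
    unfolding regular_hyperoval_def
    using hyperoval_points points_eq nucleus_std_conic[OF two beta_nonzero] by blast
qed

lemma code_from_points_points: "code_from_points (point ` {..<q + 2}) E"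
proof -
  let ?G = "mat_of_cols 3 (map column [0..<q + 2])"
  have G: "?G \<in> carrier_mat 3 (q + 2)"
    by auto
  have col: "col ?G j = column j" if "j < q + 2" for j
    using that by (subst col_mat_of_cols) (auto simp del: upt_Suc)
  interpret vec_space "TYPE('a)" "q + 2" .
  \<comment> \<open>The row space is the image of the transpose, so this identifies it with the
    range of \<open>word\<close>.\<close>
  have "?G\<^sup>T *\<^sub>v a = word a" if "a \<in> carrier_vec 3" for a
  proof (rule eq_vecI)
    show "dim_vec (?G\<^sup>T *\<^sub>v a) = dim_vec (word a)"
      using word_in[of a] carrier by auto
    fix j
    assume "j < dim_vec (word a)"
    hence "j < q + 2"
      using word_in[of a] carrier by auto
    thus "(?G\<^sup>T *\<^sub>v a) $ j = word a $ j"
      using that col by (simp add: word_index comm_scalar_prod[of a 3] del: upt_Suc)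
  qed
  hence "row_space ?G = word ` carrier_vec 3"
    using row_space_eq[OF G] word_in carrier G by (auto simp: image_iff)
  also have "\<dots> = E"
    using word_in word_eq by (auto intro!: image_eqI)
  finally have "span (set (rows ?G)) = E"
    by (simp only: row_space_def)
  hence "E = span (set (rows ?G))"
    by (rule sym)
  moreover have "bij_betw (\<lambda>j. proj_point (col ?G j)) {..<q + 2} (point ` {..<q + 2})"
    using inj_on_point col by (subst bij_betw_cong[of _ _ point]) (auto simp: bij_betw_def)
  ultimately show ?thesis
    unfolding code_from_points_def card_points using G by blast
qed

end

theorem theorem1:
  fixes E :: "'a::{field,finite} vec set" and m q :: nat
  assumes "m \<ge> 1" and "q = 2 ^ m" and "CARD('a) = q"
    and "extended_cyclic_code E"
    and "code_params (q + 2) 3 q E"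
  shows "\<exists>H D. regular_hyperoval H \<and> code_from_points H D \<and> mds_code (q + 2) D \<and>
           code_equiv (q + 2) E D"
proof -
  interpret extended_cyclic_hyperoval_code E m q
    using assms by unfold_locales
  \<comment> \<open>Here \<open>D\<close> is \<open>E\<close> itself, so the equivalence is the
    identity.\<close>
  show ?thesis
    using regular_hyperoval_points code_from_points_points mds code_equiv_refl[OF lin] by blast
qed

end
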